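(* Let $\alpha\in\mathbb{R}$, $d\in\mathbb{N}$, let $\{f_n\}_{n=1}^\infty$ be a sequence in $D_\alpha\setminus\{0\}$ and let $f\in D_\alpha\setminus\{0\}$. Let $p_d$ be the $d$-th optimal polynomial approximant to $1/f$ and $p_{d,n}$ the $d$-th optimal polynomial approximant to $1/f_n$, and let $Mc=b$ and $M_nc_n=b_n$ be the corresponding linear systems associated to $f$ and to $f_n$, respectively. Then there exists a constant $\varphi(d,\alpha)$, depending only on $d$ and $\alpha$ (in particular independent of $n$), such that for all $n\ge 1$: (a) $\|b_n-b\|_0\le \|f_n-f\|_\alpha$; (b) $\|M_n-M\|_F\le \varphi(d,\alpha)\,(\|f_n\|_\alpha+\|f\|_\alpha)\,\|f_n-f\|_\alpha$. Moreover, there exists a constant $\psi(d,\alpha)$, depending only on $d$ and $\alpha$, such that for all $n\ge 1$ $$\|p_{d,n}-p_d\|_\alpha\le \psi(d,\alpha)\,\|M_n^{-1}\|_F\left(\|b_n-b\|_0+\|M^{-1}\|_F\,\|M-M_n\|_F\,\|b\|_0\right).$$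
   Context: $\mathbb{D}$ is the open unit disc in $\mathbb{C}$. For $\alpha\in\mathbb{R}$, the Dirichlet-type space $D_\alpha$ is the Hilbert space of all analytic functions $f(z)=\sum_{k=0}^\infty a_kz^k$ on $\mathbb{D}$ with $\|f\|_\alpha^2:=\sum_{k=0}^\infty |a_k|^2(k+1)^\alpha<\infty$, with inner product $\langle f,g\rangle_\alpha=\sum_{k=0}^\infty a_k\overline{b_k}(k+1)^\alpha$ for $g(z)=\sum_{k=0}^\infty b_kz^k$. $S$ is the shift operator, $Sf(z)=zf(z)$. Let $\mathcal{P}_d$ be the space of polynomials of degree at most $d$. For $f\in D_\alpha\setminus\{0\}$, the $d$-th optimal polynomial approximant (o.p.a.) to $1/f$ is the unique polynomial $p_d\in\mathcal{P}_d$ minimizing $\|pf-1\|_\alpha$ over $p\in\mathcal{P}_d$ (equivalently, $p_df$ is the orthogonal projection of $1$ onto $f\mathcal{P}_d$). The linear system associated to $f$ (and $d$) is $Mc=b$, where $M=(m_{j,k})_{j,k=0}^d\in\mathbb{C}^{(d+1)\times(d+1)}$ has entries $m_{j,k}=\langle S^kf,S^jf\rangle_\alpha$ and $b=(b_k)_{k=0}^d\in\mathbb{C}^{d+1}$ has entries $b_k=\langle 1,S^kf\rangle_\alpha$. The matrix $M$ is invertible, and the unique solution $c=(c_0,\dots,c_d)$ is the vector of coefficients of $p_d(z)=\sum_{k=0}^dc_kz^k$. $\|\cdot\|_F$ is the Frobenius norm of matrices. For vectors in $\mathbb{C}^{d+1}$ (identified with polynomials in $\mathcal{P}_d$ via coefficients),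 $\|\cdot\|_0$ is the Euclidean norm. *)

theory Defs
  imports "HOL-Complex_Analysis.Complex_Analysis"
    "Jordan_Normal_Form.Gauss_Jordan_Elimination"
begin

unbundle no vec_syntax

text \<open>Functions on the unit disc are total functions on the complex plane of which only the
  restriction to \<^term>\<open>ball (0::complex) 1\<close> matters.\<close>

definition taylor_coeff :: "(complex \<Rightarrow> complex) \<Rightarrow> nat \<Rightarrow> complex" where
  "taylor_coeff f k = fps_nth (fps_expansion f 0) k"

definition dirichlet_space :: "real \<Rightarrow> (complex \<Rightarrow> complex) set" where
  "dirichlet_space \<alpha> = {f. f holomorphic_on ball 0 1 \<and>
     summable (\<lambda>k. (cmod (taylor_coeff f k))\<^sup>2 * (real k + 1) powr \<alpha>)}"

text \<open>Being different from the zero element means not vanishing identically on the disc.\<close>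

definition dirichlet_nonzero :: "real \<Rightarrow> (complex \<Rightarrow> complex) set" where
  "dirichlet_nonzero \<alpha> = {f \<in> dirichlet_space \<alpha>. \<exists>z\<in>ball 0 1. f z \<noteq> 0}"

definition dirichlet_norm :: "real \<Rightarrow> (complex \<Rightarrow> complex) \<Rightarrow> real" where
  "dirichlet_norm \<alpha> f =
     sqrt (\<Sum>k. (cmod (taylor_coeff f k))\<^sup>2 * (real k + 1) powr \<alpha>)"

definition dirichlet_inner ::
    "real \<Rightarrow> (complex \<Rightarrow> complex) \<Rightarrow> (complex \<Rightarrow> complex) \<Rightarrow> complex" where
  "dirichlet_inner \<alpha> f g =
     (\<Sum>k. taylor_coeff f k * cnj (taylor_coeff g k) * of_real ((real k + 1) powr \<alpha>))"

definition shift :: "(complex \<Rightarrow> complex) \<Rightarrow> complex \<Rightarrow> complex" where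
  "shift f = (\<lambda>z. z * f z)"

definition is_opa :: "real \<Rightarrow> nat \<Rightarrow> (complex \<Rightarrow> complex) \<Rightarrow> complex poly \<Rightarrow> bool" where
  "is_opa \<alpha> d f p \<longleftrightarrow> degree p \<le> d \<and>
     (\<forall>q. degree q \<le> d \<longrightarrow>
        dirichlet_norm \<alpha> (\<lambda>z. poly p z * f z - 1) \<le> dirichlet_norm \<alpha> (\<lambda>z. poly q z * f z - 1))"

definition opa :: "real \<Rightarrow> nat \<Rightarrow> (complex \<Rightarrow> complex) \<Rightarrow> complex poly" where
  "opa \<alpha> d f = (THE p. is_opa \<alpha> d f p)"

definition opa_mat :: "real \<Rightarrow> nat \<Rightarrow> (complex \<Rightarrow> complex) \<Rightarrow> complex mat" where
  "opa_mat \<alpha> d f =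
     mat (d + 1) (d + 1) (\<lambda>(j, k). dirichlet_inner \<alpha> ((shift ^^ k) f) ((shift ^^ j) f))"

definition opa_vec :: "real \<Rightarrow> nat \<Rightarrow> (complex \<Rightarrow> complex) \<Rightarrow> complex vec" where
  "opa_vec \<alpha> d f = vec (d + 1) (\<lambda>k. dirichlet_inner \<alpha> (\<lambda>_. 1) ((shift ^^ k) f))"

definition frob_norm :: "complex mat \<Rightarrow> real" where
  "frob_norm A = sqrt (\<Sum>i<dim_row A. \<Sum>j<dim_col A. (cmod (A $$ (i, j)))\<^sup>2)"

definition euclid_norm :: "complex vec \<Rightarrow> real" where
  "euclid_norm v = sqrt (\<Sum>i<dim_vec v. (cmod (v $ i))\<^sup>2)"

text \<open>\<^const>\<open>mat_inverse\<close> returns an option; \<^const>\<open>the\<close> is only meaningful for an invertible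
  matrix, such as \<^term>\<open>opa_mat \<alpha> d f\<close> for \<^term>\<open>f \<in> dirichlet_nonzero \<alpha>\<close>.\<close>

definition mat_inv :: "complex mat \<Rightarrow> complex mat" where
  "mat_inv A = the (mat_inverse A)"

end

(*
For k >= 1 the function S^k f vanishes at 0, so b has the single nonzero entry cnj (f(0)), which
gives (a).  Each entry of M_n - M splits as <S^k(f_n - f), S^j f_n> + <S^k f, S^j(f_n - f)>;
Cauchy-Schwarz and |S| <= 2^(|alpha|/2) bound it, which gives (b).  For the last estimate, M is
injective because M c = 0 forces |pf|^2 = c* M c = 0 for the polynomial p with coefficients c, and
the residual p f - 1 of a solution of M c = b is orthogonal to f P_d, so p is the unique minimizer.
Hence p_{d,n} - p_d has coefficient vector c_n - c = M_n^{-1} ((b_n - b) + (M - M_n) M^{-1} b), and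
on P_d the norm of D_alpha is at most a constant times the Euclidean norm of the coefficients.
*)

theory Submission
  imports Defs "Jordan_Normal_Form.Determinant"
begin

no_notation fps_nth (infixl "$" 75)

section \<open>Taylor coefficients at 0 via formal power series\<close>

section \<open>Taylor coefficients\<close>

lemma has_fps_expansion_unit_disc:
  "f holomorphic_on ball 0 1 \<Longrightarrow> f has_fps_expansion fps_expansion f 0"
  by (rule has_fps_expansion_fps_expansion[of "ball 0 1"]) auto

text \<open>Uniqueness of power series: every coefficient formula below reduces to exhibiting some
  formal series that the function expands to.\<close>

lemma taylor_coeff_eqI: "f has_fps_expansion F \<Longrightarrow> taylor_coeff f k = fps_nth F k"
  by (simp add: taylor_coeff_def fps_expansion_eqI)

lemma taylor_coeff_add:
  assumes "f holomorphic_on ball 0 1" "g holomorphic_on ball 0 1"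
  shows "taylor_coeff (\<lambda>z. f z + g z) k = taylor_coeff f k + taylor_coeff g k"
  using taylor_coeff_eqI[OF has_fps_expansion_add[OF assms[THEN has_fps_expansion_unit_disc]]]
  by (simp add: taylor_coeff_def)

lemma taylor_coeff_cmult:
  assumes "f holomorphic_on ball 0 1"
  shows "taylor_coeff (\<lambda>z. c * f z) k = c * taylor_coeff f k"
  using taylor_coeff_eqI[OF has_fps_expansion_cmult_left[OF has_fps_expansion_unit_disc[OF assms]]]
  by (simp add: taylor_coeff_def)

lemma taylor_coeff_shift:
  assumes "f holomorphic_on ball 0 1"
  shows "taylor_coeff (shift f) k = (if k = 0 then 0 else taylor_coeff f (k - 1))"
proof -
  have "shift f has_fps_expansion fps_X * fps_expansion f 0"
    unfolding shift_def
    by (intro has_fps_expansion_mult has_fps_expansion_fps_X has_fps_expansion_unit_disc assms)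
  from taylor_coeff_eqI[OF this] show ?thesis
    by (simp add: taylor_coeff_def)
qed

lemma has_fps_expansion_poly: "poly p has_fps_expansion fps_of_poly p" for p :: "complex poly"
proof -
  have "eval_fps (fps_of_poly p) has_fps_expansion fps_of_poly p"
    by (rule eval_fps_has_fps_expansion) simp
  then show ?thesis by (simp add: eval_fps_of_poly[abs_def])
qed

lemma taylor_coeff_poly: "taylor_coeff (poly p) k = coeff p k"
  using taylor_coeff_eqI[OF has_fps_expansion_poly] by simp

lemma taylor_coeff_one: "taylor_coeff (\<lambda>_. 1) k = (if k = 0 then 1 else 0)"
  using taylor_coeff_poly[of 1 k] by (simp add: poly_1[abs_def])

text \<open>Identity theorem: if all coefficients vanished, so would all derivatives at 0, and hence
  the function on the whole disc.\<close>

lemma taylor_coeff_nonzero: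
  assumes "f holomorphic_on ball 0 1" "z \<in> ball 0 1" "f z \<noteq> 0"
  obtains k where "taylor_coeff f k \<noteq> 0"
proof -
  have "\<exists>k. taylor_coeff f k \<noteq> 0"
  proof (rule ccontr)
    assume "\<not> ?thesis"
    then have "(deriv ^^ n) f 0 = 0" for n
      by (auto simp: taylor_coeff_def fps_expansion_def)
    then show False
      using holomorphic_fun_eq_0_on_ball[OF assms(1,2)] assms(3) by blast
  qed
  then show thesis using that by blast
qed

section \<open>Closure of the space under linear combinations and the shift\<close>

section \<open>The space \<open>D\<^sub>\<alpha>\<close>\<close>

lemma dirichlet_space_holomorphic: "f \<in> dirichlet_space \<alpha> \<Longrightarrow> f holomorphic_on ball 0 1"
  by (simp add: dirichlet_space_def)

lemma dirichlet_space_summable: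
  "f \<in> dirichlet_space \<alpha> \<Longrightarrow> summable (\<lambda>k. (cmod (taylor_coeff f k))\<^sup>2 * (real k + 1) powr \<alpha>)"
  by (simp add: dirichlet_space_def)

text \<open>Termwise comparison through |a + b|^2 \<le> 2(|a|^2 + |b|^2), multiplied by the
  weight.\<close>

lemma dirichlet_space_add:
  assumes "f \<in> dirichlet_space \<alpha>" "g \<in> dirichlet_space \<alpha>"
  shows "(\<lambda>z. f z + g z) \<in> dirichlet_space \<alpha>"
proof -
  note hol = assms[THEN dirichlet_space_holomorphic]
  have "summable (\<lambda>k. (cmod (taylor_coeff f k + taylor_coeff g k))\<^sup>2 * (real k + 1) powr \<alpha>)"
  proof (rule summable_comparison_test')
    show "summable (\<lambda>k. 2 * ((cmod (taylor_coeff f k))\<^sup>2 * (real k + 1) powr \<alpha>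
        + (cmod (taylor_coeff g k))\<^sup>2 * (real k + 1) powr \<alpha>))"
      by (intro summable_mult summable_add dirichlet_space_summable assms)
    fix k
    have "(cmod (taylor_coeff f k + taylor_coeff g k))\<^sup>2
        \<le> (cmod (taylor_coeff f k) + cmod (taylor_coeff g k))\<^sup>2"
      by (intro power_mono norm_triangle_ineq) simp
    also have "\<dots> \<le> 2 * ((cmod (taylor_coeff f k))\<^sup>2 + (cmod (taylor_coeff g k))\<^sup>2)"
      using sum_squares_bound[of "cmod (taylor_coeff f k)" "cmod (taylor_coeff g k)"]
      by (simp add: power2_sum)
    finally show "norm ((cmod (taylor_coeff f k + taylor_coeff g k))\<^sup>2 * (real k + 1) powr \<alpha>)
        \<le> 2 * ((cmod (taylor_coeff f k))\<^sup>2 * (real k + 1) powr \<alpha>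
          + (cmod (taylor_coeff g k))\<^sup>2 * (real k + 1) powr \<alpha>)"
      using mult_right_mono[of _ _ "(real k + 1) powr \<alpha>"] by (fastforce simp: algebra_simps)
  qed
  then show ?thesis
    using hol by (auto simp: dirichlet_space_def taylor_coeff_add intro!: holomorphic_intros)
qed

lemma dirichlet_space_cmult:
  assumes "f \<in> dirichlet_space \<alpha>"
  shows "(\<lambda>z. c * f z) \<in> dirichlet_space \<alpha>"
  using dirichlet_space_holomorphic[OF assms] summable_mult[OF dirichlet_space_summable[OF assms]]
  by (auto simp: dirichlet_space_def taylor_coeff_cmult norm_mult power_mult_distrib mult.assoc
      intro!: holomorphic_intros)

lemma dirichlet_space_diff:
  assumes "f \<in> dirichlet_space \<alpha>" "g \<in> dirichlet_space \<alpha>"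
  shows "(\<lambda>z. f z - g z) \<in> dirichlet_space \<alpha>"
  using dirichlet_space_add[OF assms(1) dirichlet_space_cmult[OF assms(2), of "-1"]] by simp

text \<open>The ratio (k+2)/(k+1) of consecutive bases lies between 1 and 2, so passing from the
  exponent \<alpha> to its absolute value only increases the power. One bound thus covers weights
  that grow and weights that decay.\<close>

lemma dirichlet_weight_Suc:
  "(real (Suc k) + 1) powr \<alpha> \<le> 2 powr \<bar>\<alpha>\<bar> * (real k + 1) powr \<alpha>"
proof -
  have "(real (Suc k) + 1) powr \<alpha> = ((real (Suc k) + 1) / (real k + 1)) powr \<alpha> * (real k + 1) powr \<alpha>"
    by (simp add: powr_divide)
  also have "((real (Suc k) + 1) / (real k + 1)) powr \<alpha> \<le> ((real (Suc k) + 1) / (real k + 1)) powr \<bar>\<alpha>\<bar>"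
    by (intro powr_mono) auto
  also have "\<dots> \<le> 2 powr \<bar>\<alpha>\<bar>"
    by (intro powr_mono2) (auto simp: field_simps)
  finally show ?thesis by (simp add: mult_right_mono)
qed

text \<open>The shift moves coefficient k to position k + 1, so only the weights have to be
  compared. This serves both for membership of \<open>shift f\<close> in the space and for its
  norm.\<close>

lemma dirichlet_shift_term_le:
  assumes "f \<in> dirichlet_space \<alpha>"
  shows "(cmod (taylor_coeff (shift f) (Suc k)))\<^sup>2 * (real (Suc k) + 1) powr \<alpha>
    \<le> 2 powr \<bar>\<alpha>\<bar> * ((cmod (taylor_coeff f k))\<^sup>2 * (real k + 1) powr \<alpha>)"
  using mult_left_mono[OF dirichlet_weight_Suc, of "(cmod (taylor_coeff f k))\<^sup>2" k \<alpha>]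
    dirichlet_space_holomorphic[OF assms]
  by (simp add: taylor_coeff_shift mult_ac)

lemma dirichlet_space_shift:
  assumes "f \<in> dirichlet_space \<alpha>"
  shows "shift f \<in> dirichlet_space \<alpha>"
proof -
  have "summable (\<lambda>k. (cmod (taylor_coeff (shift f) (Suc k)))\<^sup>2 * (real (Suc k) + 1) powr \<alpha>)"
    by (rule summable_comparison_test'[OF summable_mult[OF dirichlet_space_summable[OF assms]]])
      (use dirichlet_shift_term_le[OF assms] in auto)
  then have "summable (\<lambda>k. (cmod (taylor_coeff (shift f) k))\<^sup>2 * (real k + 1) powr \<alpha>)"
    by (subst (asm) summable_Suc_iff)
  moreover have "shift f holomorphic_on ball 0 1"
    unfolding shift_def using dirichlet_space_holomorphic[OF assms]
    by (intro holomorphic_intros)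
  ultimately show ?thesis by (simp add: dirichlet_space_def)
qed

lemma dirichlet_space_shift_pow:
  "f \<in> dirichlet_space \<alpha> \<Longrightarrow> (shift ^^ k) f \<in> dirichlet_space \<alpha>"
  by (induction k) (auto intro: dirichlet_space_shift)

lemma dirichlet_space_one: "(\<lambda>_. 1) \<in> dirichlet_space \<alpha>"
proof -
  have "summable (\<lambda>k. (cmod (taylor_coeff (\<lambda>_. 1) k))\<^sup>2 * (real k + 1) powr \<alpha>)"
    by (rule summable_finite[of "{0}"]) (simp_all add: taylor_coeff_one)
  then show ?thesis by (simp add: dirichlet_space_def)
qed

lemma dirichlet_space_sum:
  assumes "finite A" "\<And>k. k \<in> A \<Longrightarrow> g k \<in> dirichlet_space \<alpha>"
  shows "(\<lambda>z. \<Sum>k\<in>A. c k * g k z) \<in> dirichlet_space \<alpha>"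
  using assms
proof (induction A)
  case empty
  \<comment> \<open>The empty sum is the zero function, obtained as 0 times the constant 1.\<close>
  show ?case using dirichlet_space_cmult[OF dirichlet_space_one, of 0] by simp
next
  case (insert x A)
  then show ?case by (auto intro!: dirichlet_space_add dirichlet_space_cmult)
qed

section \<open>Sesquilinearity, Pythagoras, Cauchy-Schwarz and the norm of the shift\<close>

section \<open>Inner product and norm\<close>

lemma dirichlet_norm_nonneg: "f \<in> dirichlet_space \<alpha> \<Longrightarrow> 0 \<le> dirichlet_norm \<alpha> f"
  unfolding dirichlet_norm_def
  by (intro real_sqrt_ge_zero suminf_nonneg dirichlet_space_summable) auto

lemma dirichlet_norm_sq:
  assumes "f \<in> dirichlet_space \<alpha>"
  shows "(dirichlet_norm \<alpha> f)\<^sup>2 = (\<Sum>k. (cmod (taylor_coeff f k))\<^sup>2 * (real k + 1) powr \<alpha>)"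
  unfolding dirichlet_norm_def
  by (intro real_sqrt_pow2 suminf_nonneg dirichlet_space_summable assms) auto

text \<open>Comparison with the two norm series by ab \<le> a^2 + b^2 for a, b \<ge> 0. The absolute
  convergence gained here justifies the manipulations of the inner product series.\<close>

lemma summable_dirichlet_inner_norm:
  assumes "f \<in> dirichlet_space \<alpha>" "g \<in> dirichlet_space \<alpha>"
  shows "summable (\<lambda>k. cmod (taylor_coeff f k) * cmod (taylor_coeff g k) * (real k + 1) powr \<alpha>)"
proof (rule summable_comparison_test')
  show "summable (\<lambda>k. (cmod (taylor_coeff f k))\<^sup>2 * (real k + 1) powr \<alpha>
      + (cmod (taylor_coeff g k))\<^sup>2 * (real k + 1) powr \<alpha>)"
    by (intro summable_add dirichlet_space_summable assms)
  fix k
  have "cmod (taylor_coeff f k) * cmod (taylor_coeff g k)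
      \<le> (cmod (taylor_coeff f k))\<^sup>2 + (cmod (taylor_coeff g k))\<^sup>2"
    using sum_squares_bound[of "cmod (taylor_coeff f k)" "cmod (taylor_coeff g k)"]
      mult_nonneg_nonneg[OF norm_ge_zero norm_ge_zero, of "taylor_coeff f k" "taylor_coeff g k"]
    by linarith
  from mult_right_mono[OF this, of "(real k + 1) powr \<alpha>"]
  show "norm (cmod (taylor_coeff f k) * cmod (taylor_coeff g k) * (real k + 1) powr \<alpha>)
      \<le> (cmod (taylor_coeff f k))\<^sup>2 * (real k + 1) powr \<alpha>
      + (cmod (taylor_coeff g k))\<^sup>2 * (real k + 1) powr \<alpha>"
    by (simp add: algebra_simps)
qed

lemma summable_dirichlet_inner:
  assumes "f \<in> dirichlet_space \<alpha>" "g \<in> dirichlet_space \<alpha>"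
  shows "summable (\<lambda>k. taylor_coeff f k * cnj (taylor_coeff g k) * of_real ((real k + 1) powr \<alpha>))"
  by (rule summable_norm_cancel)
    (use summable_dirichlet_inner_norm[OF assms] in \<open>simp add: norm_mult\<close>)

lemma dirichlet_inner_add_left:
  assumes "f \<in> dirichlet_space \<alpha>" "g \<in> dirichlet_space \<alpha>" "h \<in> dirichlet_space \<alpha>"
  shows "dirichlet_inner \<alpha> (\<lambda>z. f z + g z) h = dirichlet_inner \<alpha> f h + dirichlet_inner \<alpha> g h"
  using suminf_add[OF summable_dirichlet_inner[OF assms(1,3)] summable_dirichlet_inner[OF assms(2,3)]]
    assms(1,2)[THEN dirichlet_space_holomorphic]
  by (simp add: dirichlet_inner_def taylor_coeff_add algebra_simps)

lemma dirichlet_inner_cmult_left: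
  assumes "f \<in> dirichlet_space \<alpha>" "h \<in> dirichlet_space \<alpha>"
  shows "dirichlet_inner \<alpha> (\<lambda>z. c * f z) h = c * dirichlet_inner \<alpha> f h"
  using suminf_mult[OF summable_dirichlet_inner[OF assms], of c]
    dirichlet_space_holomorphic[OF assms(1)]
  by (simp add: dirichlet_inner_def taylor_coeff_cmult algebra_simps)

lemma dirichlet_inner_cnj:
  assumes "f \<in> dirichlet_space \<alpha>" "g \<in> dirichlet_space \<alpha>"
  shows "cnj (dirichlet_inner \<alpha> f g) = dirichlet_inner \<alpha> g f"
  using sums_unique[OF iffD2[OF sums_cnj summable_sums[OF summable_dirichlet_inner[OF assms]]]]
  by (simp add: dirichlet_inner_def mult.commute)

lemma dirichlet_inner_diff_left:
  assumes "f \<in> dirichlet_space \<alpha>" "g \<in> dirichlet_space \<alpha>" "h \<in> dirichlet_space \<alpha>"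
  shows "dirichlet_inner \<alpha> (\<lambda>z. f z - g z) h = dirichlet_inner \<alpha> f h - dirichlet_inner \<alpha> g h"
  using dirichlet_inner_add_left[OF assms(1) dirichlet_space_cmult[OF assms(2), of "-1"] assms(3)]
    dirichlet_inner_cmult_left[OF assms(2,3), of "-1"]
  by simp

text \<open>Conjugate symmetry carries the rule over from the first argument.\<close>

lemma dirichlet_inner_diff_right:
  assumes "f \<in> dirichlet_space \<alpha>" "g \<in> dirichlet_space \<alpha>" "h \<in> dirichlet_space \<alpha>"
  shows "dirichlet_inner \<alpha> h (\<lambda>z. f z - g z) = dirichlet_inner \<alpha> h f - dirichlet_inner \<alpha> h g"
  using dirichlet_inner_diff_left[OF assms, THEN arg_cong[of _ _ cnj]] assms
  by (simp add: dirichlet_inner_cnj dirichlet_space_diff)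

lemma dirichlet_inner_sum_left:
  assumes "finite A" "\<And>k. k \<in> A \<Longrightarrow> g k \<in> dirichlet_space \<alpha>" "h \<in> dirichlet_space \<alpha>"
  shows "dirichlet_inner \<alpha> (\<lambda>z. \<Sum>k\<in>A. c k * g k z) h = (\<Sum>k\<in>A. c k * dirichlet_inner \<alpha> (g k) h)"
  using assms
proof (induction A)
  case empty
  show ?case using dirichlet_inner_cmult_left[OF dirichlet_space_one empty(2), of 0] by simp
next
  case (insert x A)
  then show ?case
    by (simp add: dirichlet_inner_add_left dirichlet_inner_cmult_left dirichlet_space_cmult
        dirichlet_space_sum)
qed

lemma dirichlet_inner_self:
  assumes "f \<in> dirichlet_space \<alpha>"
  shows "dirichlet_inner \<alpha> f f = of_real ((dirichlet_norm \<alpha> f)\<^sup>2)"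
  unfolding dirichlet_norm_sq[OF assms] dirichlet_inner_def
    suminf_of_real[OF dirichlet_space_summable[OF assms]]
  by (simp add: complex_norm_square[symmetric] del: of_real_power)

text \<open>Pythagoras. The second argument is expanded by conjugating, since additivity is
  available for the first one; the identity is proved in the complex numbers and read back by
  injectivity of \<open>of_real\<close>.\<close>

lemma dirichlet_norm_add_sq_orthogonal:
  assumes "f \<in> dirichlet_space \<alpha>" "g \<in> dirichlet_space \<alpha>" "dirichlet_inner \<alpha> f g = 0"
  shows "(dirichlet_norm \<alpha> (\<lambda>z. f z + g z))\<^sup>2 = (dirichlet_norm \<alpha> f)\<^sup>2 + (dirichlet_norm \<alpha> g)\<^sup>2"
proof -
  let ?s = "\<lambda>z. f z + g z"
  have s: "?s \<in> dirichlet_space \<alpha>" using assms by (intro dirichlet_space_add)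
  have "dirichlet_inner \<alpha> g f = 0"
    using dirichlet_inner_cnj[OF assms(1,2)] assms(3) by simp
  moreover have "dirichlet_inner \<alpha> ?s f = dirichlet_inner \<alpha> f f + dirichlet_inner \<alpha> g f"
    "dirichlet_inner \<alpha> ?s g = dirichlet_inner \<alpha> f g + dirichlet_inner \<alpha> g g"
    "dirichlet_inner \<alpha> ?s ?s = dirichlet_inner \<alpha> f ?s + dirichlet_inner \<alpha> g ?s"
    using dirichlet_inner_add_left[OF assms(1,2)] assms(1,2) s by blast+
  moreover have "dirichlet_inner \<alpha> f ?s = cnj (dirichlet_inner \<alpha> ?s f)"
    "dirichlet_inner \<alpha> g ?s = cnj (dirichlet_inner \<alpha> ?s g)"
    using assms s by (auto simp: dirichlet_inner_cnj)
  ultimately have "complex_of_real ((dirichlet_norm \<alpha> ?s)\<^sup>2)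
      = of_real ((dirichlet_norm \<alpha> f)\<^sup>2 + (dirichlet_norm \<alpha> g)\<^sup>2)"
    using assms s by (simp add: dirichlet_inner_self del: of_real_power)
  then show ?thesis by (simp only: of_real_eq_iff)
qed

text \<open>One term of a series of nonnegative terms is at most its sum. With k = 0, where the
  weight is 1, it bounds the difference of right-hand sides; over all k it shows that norm zero
  kills every coefficient.\<close>

lemma dirichlet_norm_coeff_le:
  assumes "f \<in> dirichlet_space \<alpha>"
  shows "cmod (taylor_coeff f k) * sqrt ((real k + 1) powr \<alpha>) \<le> dirichlet_norm \<alpha> f"
proof -
  have "(\<Sum>j\<in>{k}. (cmod (taylor_coeff f j))\<^sup>2 * (real j + 1) powr \<alpha>)
      \<le> (\<Sum>j. (cmod (taylor_coeff f j))\<^sup>2 * (real j + 1) powr \<alpha>)"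
    by (rule sum_le_suminf[OF dirichlet_space_summable[OF assms]]) auto
  then show ?thesis
    unfolding dirichlet_norm_def by (intro real_le_rsqrt) (simp add: power_mult_distrib)
qed

lemma dirichlet_Cauchy_Schwarz:
  assumes "f \<in> dirichlet_space \<alpha>" "g \<in> dirichlet_space \<alpha>"
  shows "cmod (dirichlet_inner \<alpha> f g) \<le> dirichlet_norm \<alpha> f * dirichlet_norm \<alpha> g"
proof -
  \<comment> \<open>The weight is shared equally between the two factors, so that the finite
    Cauchy-Schwarz inequality applies to the partial sums of the series of absolute values.\<close>
  define w where "w k = sqrt ((real k + 1) powr \<alpha>)" for k
  have w: "(w k)\<^sup>2 = (real k + 1) powr \<alpha>" "w k * w k = (real k + 1) powr \<alpha>" "0 \<le> w k" for k
    by (auto simp: w_def)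
  have partial: "L2_set (\<lambda>k. cmod (taylor_coeff h k) * w k) {..<n} \<le> dirichlet_norm \<alpha> h"
    if "h \<in> dirichlet_space \<alpha>" for h n
    unfolding L2_set_def dirichlet_norm_def power_mult_distrib w
    by (intro real_sqrt_le_mono sum_le_suminf dirichlet_space_summable that) auto
  have "cmod (dirichlet_inner \<alpha> f g)
      \<le> (\<Sum>k. cmod (taylor_coeff f k) * cmod (taylor_coeff g k) * (real k + 1) powr \<alpha>)"
    unfolding dirichlet_inner_def
    using summable_norm[of "\<lambda>k. taylor_coeff f k * cnj (taylor_coeff g k) * of_real ((real k + 1) powr \<alpha>)"]
      summable_dirichlet_inner_norm[OF assms]
    by (simp add: norm_mult)
  also have "\<dots> \<le> dirichlet_norm \<alpha> f * dirichlet_norm \<alpha> g"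
  proof (rule suminf_le_const[OF summable_dirichlet_inner_norm[OF assms]])
    fix n
    have "(\<Sum>k<n. cmod (taylor_coeff f k) * cmod (taylor_coeff g k) * (real k + 1) powr \<alpha>)
        = (\<Sum>k<n. \<bar>cmod (taylor_coeff f k) * w k\<bar> * \<bar>cmod (taylor_coeff g k) * w k\<bar>)"
      by (intro sum.cong refl) (simp add: w(2)[symmetric] abs_mult w(3))
    also have "\<dots> \<le> L2_set (\<lambda>k. cmod (taylor_coeff f k) * w k) {..<n}
        * L2_set (\<lambda>k. cmod (taylor_coeff g k) * w k) {..<n}"
      by (rule L2_set_mult_ineq)
    also have "\<dots> \<le> dirichlet_norm \<alpha> f * dirichlet_norm \<alpha> g"
      by (intro mult_mono partial assms dirichlet_norm_nonneg L2_set_nonneg)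
    finally show "(\<Sum>k<n. cmod (taylor_coeff f k) * cmod (taylor_coeff g k) * (real k + 1) powr \<alpha>)
        \<le> dirichlet_norm \<alpha> f * dirichlet_norm \<alpha> g" .
  qed
  finally show ?thesis .
qed

lemma dirichlet_norm_shift_le:
  assumes "f \<in> dirichlet_space \<alpha>"
  shows "dirichlet_norm \<alpha> (shift f) \<le> sqrt (2 powr \<bar>\<alpha>\<bar>) * dirichlet_norm \<alpha> f"
proof -
  let ?t = "\<lambda>f k. (cmod (taylor_coeff f k))\<^sup>2 * (real k + 1) powr \<alpha>"
  note sf = dirichlet_space_summable[OF assms]
  note ss = dirichlet_space_summable[OF dirichlet_space_shift[OF assms]]
  \<comment> \<open>The constant coefficient of \<open>shift f\<close> is 0, so dropping the head of
    the series loses nothing.\<close>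
  have "(\<Sum>k. ?t (shift f) k) = (\<Sum>k. ?t (shift f) (Suc k))"
    using suminf_split_head[OF ss] dirichlet_space_holomorphic[OF assms]
    by (simp add: taylor_coeff_shift)
  also have "\<dots> \<le> (\<Sum>k. 2 powr \<bar>\<alpha>\<bar> * ?t f k)"
    using ss by (intro suminf_le dirichlet_shift_term_le assms summable_mult sf)
      (subst summable_Suc_iff)
  also have "\<dots> = 2 powr \<bar>\<alpha>\<bar> * (\<Sum>k. ?t f k)"
    by (rule suminf_mult[OF sf])
  finally show ?thesis
    unfolding dirichlet_norm_def real_sqrt_mult[symmetric] by (rule real_sqrt_le_mono)
qed

text \<open>The exponent d instead of k makes the constant uniform over all shifts that occur in the
  matrix; this is legitimate because the base is at least 1.\<close>

lemma dirichlet_norm_shift_pow_le: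
  assumes "f \<in> dirichlet_space \<alpha>" "k \<le> d"
  shows "dirichlet_norm \<alpha> ((shift ^^ k) f) \<le> sqrt (2 powr \<bar>\<alpha>\<bar>) ^ d * dirichlet_norm \<alpha> f"
proof -
  have K: "1 \<le> sqrt (2 powr \<bar>\<alpha>\<bar>)" by (simp add: ge_one_powr_ge_zero)
  have "dirichlet_norm \<alpha> ((shift ^^ k) f) \<le> sqrt (2 powr \<bar>\<alpha>\<bar>) ^ k * dirichlet_norm \<alpha> f" for k
  proof (induction k)
    case (Suc k)
    have "dirichlet_norm \<alpha> ((shift ^^ Suc k) f)
        \<le> sqrt (2 powr \<bar>\<alpha>\<bar>) * dirichlet_norm \<alpha> ((shift ^^ k) f)"
      using dirichlet_norm_shift_le[OF dirichlet_space_shift_pow[OF assms(1)]] by simp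
    also have "\<dots> \<le> sqrt (2 powr \<bar>\<alpha>\<bar>) * (sqrt (2 powr \<bar>\<alpha>\<bar>) ^ k * dirichlet_norm \<alpha> f)"
      by (intro mult_left_mono Suc) simp
    finally show ?case by simp
  qed simp
  also have "sqrt (2 powr \<bar>\<alpha>\<bar>) ^ k * dirichlet_norm \<alpha> f \<le> sqrt (2 powr \<bar>\<alpha>\<bar>) ^ d * dirichlet_norm \<alpha> f"
    by (intro mult_right_mono power_increasing assms K dirichlet_norm_nonneg)
  finally show ?thesis .
qed

section \<open>The subspace f P_d, spanned by the shifts of f\<close>

section \<open>Polynomial multiples of \<open>f\<close>\<close>

lemma shift_pow_eq: "(shift ^^ k) f z = z ^ k * f z"
  by (induction k) (auto simp: shift_def)

lemma shift_pow_diff: "(shift ^^ k) (\<lambda>z. f z - g z) = (\<lambda>z. (shift ^^ k) f z - (shift ^^ k) g z)"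
  by (auto simp: shift_pow_eq right_diff_distrib)

text \<open>The sum runs up to d rather than to the degree, so that its index range is that of the
  linear system.\<close>

lemma poly_mult_eq_shift_sum:
  assumes "degree p \<le> d"
  shows "(\<lambda>z. poly p z * f z) = (\<lambda>z. \<Sum>k\<le>d. coeff p k * (shift ^^ k) f z)"
proof
  fix z
  have "poly p z = (\<Sum>k\<le>d. coeff p k * z ^ k)"
    unfolding poly_altdef using assms
    by (intro sum.mono_neutral_left) (auto simp: coeff_eq_0)
  then show "poly p z * f z = (\<Sum>k\<le>d. coeff p k * (shift ^^ k) f z)"
    by (simp add: sum_distrib_right shift_pow_eq mult.assoc)
qed

lemma dirichlet_space_poly_mult:
  "f \<in> dirichlet_space \<alpha> \<Longrightarrow> (\<lambda>z. poly p z * f z) \<in> dirichlet_space \<alpha>"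
  by (simp add: poly_mult_eq_shift_sum[OF order_refl] dirichlet_space_sum dirichlet_space_shift_pow)

lemma dirichlet_inner_poly_mult_left:
  assumes "f \<in> dirichlet_space \<alpha>" "h \<in> dirichlet_space \<alpha>" "degree p \<le> d"
  shows "dirichlet_inner \<alpha> (\<lambda>z. poly p z * f z) h
    = (\<Sum>k\<le>d. coeff p k * dirichlet_inner \<alpha> ((shift ^^ k) f) h)"
  using assms by (simp add: poly_mult_eq_shift_sum dirichlet_inner_sum_left dirichlet_space_shift_pow)

text \<open>Orthogonality to the generators S^k f extends to their span; conjugation moves the span
  into the first argument, where linearity applies.\<close>

lemma dirichlet_inner_poly_mult_right_eq_0:
  assumes "f \<in> dirichlet_space \<alpha>" "h \<in> dirichlet_space \<alpha>" "degree p \<le> d"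
    and "\<And>k. k \<le> d \<Longrightarrow> dirichlet_inner \<alpha> h ((shift ^^ k) f) = 0"
  shows "dirichlet_inner \<alpha> h (\<lambda>z. poly p z * f z) = 0"
proof -
  have "dirichlet_inner \<alpha> ((shift ^^ k) f) h = 0" if "k \<le> d" for k
    using dirichlet_inner_cnj[OF assms(2) dirichlet_space_shift_pow[OF assms(1)], of k] assms(4)[OF that]
    by simp
  then have "dirichlet_inner \<alpha> (\<lambda>z. poly p z * f z) h = 0"
    using assms(1-3) by (simp add: dirichlet_inner_poly_mult_left)
  then show ?thesis
    using dirichlet_inner_cnj[OF dirichlet_space_poly_mult[OF assms(1)] assms(2), of p] by simp
qed

text \<open>Norm zero makes the product of the two formal power series zero. Formal power series
  have no zero divisors and the series of f is nonzero, so that of p vanishes.\<close>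

lemma poly_mult_norm_eq_0:
  assumes "f \<in> dirichlet_nonzero \<alpha>" "dirichlet_norm \<alpha> (\<lambda>z. poly p z * f z) = 0"
  shows "p = 0"
proof -
  from assms(1) obtain z where f: "f \<in> dirichlet_space \<alpha>" and z: "z \<in> ball 0 1" "f z \<noteq> 0"
    by (auto simp: dirichlet_nonzero_def)
  note hol = dirichlet_space_holomorphic[OF f]
  have "taylor_coeff (\<lambda>z. poly p z * f z) k = 0" for k
  proof -
    have "cmod (taylor_coeff (\<lambda>z. poly p z * f z) k) * sqrt ((real k + 1) powr \<alpha>) \<le> 0"
      using dirichlet_norm_coeff_le[OF dirichlet_space_poly_mult[OF f]] assms(2) by metis
    then show ?thesis by (auto simp: mult_le_0_iff)
  qed
  moreover have "(\<lambda>z. poly p z * f z) has_fps_expansion fps_of_poly p * fps_expansion f 0"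
    by (intro has_fps_expansion_mult has_fps_expansion_poly has_fps_expansion_unit_disc hol)
  ultimately have "fps_of_poly p * fps_expansion f 0 = 0"
    using taylor_coeff_eqI by (metis fps_ext fps_zero_nth)
  moreover have "fps_expansion f 0 \<noteq> 0"
    using taylor_coeff_nonzero[OF hol z] by (metis fps_zero_nth taylor_coeff_def)
  ultimately show ?thesis by simp
qed

text \<open>Each |c_k|^2 is bounded by the full sum of squares, which leaves the sum of the weights
  as a factor. Its square root is the constant \<psi> of the theorem.\<close>

lemma dirichlet_norm_poly_le:
  assumes "degree p \<le> d"
  shows "dirichlet_norm \<alpha> (poly p)
    \<le> sqrt (\<Sum>k\<le>d. (real k + 1) powr \<alpha>) * euclid_norm (vec (d + 1) (coeff p))"
proof -
  have "(\<Sum>k. (cmod (coeff p k))\<^sup>2 * (real k + 1) powr \<alpha>)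
      = (\<Sum>k\<le>d. (cmod (coeff p k))\<^sup>2 * (real k + 1) powr \<alpha>)"
    using assms by (intro suminf_finite) (auto simp: coeff_eq_0)
  also have "\<dots> \<le> (\<Sum>k\<le>d. (\<Sum>j\<le>d. (cmod (coeff p j))\<^sup>2) * (real k + 1) powr \<alpha>)"
    by (intro sum_mono mult_right_mono member_le_sum) auto
  also have "\<dots> = (\<Sum>k\<le>d. (real k + 1) powr \<alpha>) * (\<Sum>j\<le>d. (cmod (coeff p j))\<^sup>2)"
    by (simp add: sum_distrib_left[symmetric] sum_distrib_right mult.commute)
  finally show ?thesis
    unfolding dirichlet_norm_def euclid_norm_def real_sqrt_mult[symmetric] taylor_coeff_poly
    by (intro real_sqrt_le_mono) (simp add: lessThan_Suc_atMost)
qed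

section \<open>Compatibility of the matrix and vector norms\<close>

section \<open>Frobenius and Euclidean norms\<close>

lemma euclid_norm_L2_set: "euclid_norm v = L2_set (\<lambda>i. cmod (v $ i)) {..<dim_vec v}"
  by (simp add: euclid_norm_def L2_set_def)

text \<open>Reading the Frobenius norm as the Euclidean norm of the row norms makes the
  \<open>L2_set\<close> inequalities applicable.\<close>

lemma frob_norm_L2_set:
  "frob_norm A = L2_set (\<lambda>i. L2_set (\<lambda>j. cmod (A $$ (i, j))) {..<dim_col A}) {..<dim_row A}"
  by (simp add: frob_norm_def L2_set_def sum_nonneg)

lemma frob_norm_nonneg: "0 \<le> frob_norm A"
  by (simp add: frob_norm_L2_set)

lemma euclid_norm_add_le:
  assumes "dim_vec v = dim_vec w"
  shows "euclid_norm (v + w) \<le> euclid_norm v + euclid_norm w"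
proof -
  have "euclid_norm (v + w) \<le> L2_set (\<lambda>i. cmod (v $ i) + cmod (w $ i)) {..<dim_vec w}"
    unfolding euclid_norm_L2_set
    by (simp, intro L2_set_mono) (auto intro: norm_triangle_ineq)
  also have "\<dots> \<le> euclid_norm v + euclid_norm w"
    unfolding euclid_norm_L2_set assms by (rule L2_set_triangle_ineq)
  finally show ?thesis .
qed

text \<open>Cauchy-Schwarz in each row; the common factor \<open>euclid_norm v\<close> then leaves
  the outer norm.\<close>

lemma euclid_norm_mult_mat_vec_le:
  assumes "dim_col A = dim_vec v"
  shows "euclid_norm (A *\<^sub>v v) \<le> frob_norm A * euclid_norm v"
proof -
  have "cmod ((A *\<^sub>v v) $ i) \<le> L2_set (\<lambda>j. cmod (A $$ (i, j))) {..<dim_col A} * euclid_norm v"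
    if "i < dim_row A" for i
  proof -
    have "cmod ((A *\<^sub>v v) $ i) \<le> (\<Sum>j<dim_vec v. \<bar>cmod (A $$ (i, j))\<bar> * \<bar>cmod (v $ j)\<bar>)"
      using that assms
      by (auto simp: scalar_prod_def atLeast0LessThan norm_mult[symmetric] intro!: sum_norm_le)
    also have "\<dots> \<le> L2_set (\<lambda>j. cmod (A $$ (i, j))) {..<dim_vec v} * euclid_norm v"
      unfolding euclid_norm_L2_set by (rule L2_set_mult_ineq)
    finally show ?thesis using assms by simp
  qed
  then have "euclid_norm (A *\<^sub>v v)
      \<le> L2_set (\<lambda>i. L2_set (\<lambda>j. cmod (A $$ (i, j))) {..<dim_col A} * euclid_norm v) {..<dim_row A}"
    unfolding euclid_norm_L2_set[of "A *\<^sub>v v"] by (simp, intro L2_set_mono) auto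
  also have "\<dots> = frob_norm A * euclid_norm v"
    unfolding frob_norm_L2_set
    by (rule L2_set_left_distrib[symmetric]) (simp add: euclid_norm_L2_set)
  finally show ?thesis .
qed

lemma frob_norm_le_entries:
  assumes "A \<in> carrier_mat n n" "0 \<le> C" "\<And>i j. i < n \<Longrightarrow> j < n \<Longrightarrow> cmod (A $$ (i, j)) \<le> C"
  shows "frob_norm A \<le> real n * C"
proof -
  have "(\<Sum>i<n. \<Sum>j<n. (cmod (A $$ (i, j)))\<^sup>2) \<le> (\<Sum>i<n. \<Sum>j<n. C\<^sup>2)"
    using assms by (intro sum_mono power_mono) auto
  also have "\<dots> = (real n * C)\<^sup>2" by (simp add: power2_eq_square)
  finally show ?thesis
    using assms unfolding frob_norm_def by (intro real_le_lsqrt) (auto simp: sum_nonneg)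
qed

section \<open>Invertibility of M, and the o.p.a. as the solution of the system\<close>

section \<open>The linear system of an optimal polynomial approximant\<close>

lemma opa_mat_carrier: "opa_mat \<alpha> d f \<in> carrier_mat (d + 1) (d + 1)"
  by (simp add: opa_mat_def)

lemma opa_vec_carrier: "opa_vec \<alpha> d f \<in> carrier_vec (d + 1)"
  by (simp add: opa_vec_def)

text \<open>Translates between the system and the space: column k carries S^k f in the linear first
  argument, so row j assembles the product p f tested against S^j f.\<close>

lemma opa_mat_mult_coeff:
  assumes "f \<in> dirichlet_space \<alpha>" "degree p \<le> d" "j \<le> d"
  shows "(opa_mat \<alpha> d f *\<^sub>v vec (d + 1) (coeff p)) $ j
    = dirichlet_inner \<alpha> (\<lambda>z. poly p z * f z) ((shift ^^ j) f)"
  using assms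
  unfolding dirichlet_inner_poly_mult_left[OF assms(1) dirichlet_space_shift_pow[OF assms(1)] assms(2)]
  by (simp add: opa_mat_def scalar_prod_def atLeast0LessThan lessThan_Suc_atMost mult.commute
      del: sum.lessThan_Suc)

text \<open>Lets an arbitrary vector be read as a polynomial in P_d.\<close>

lemma coeff_vec_surj:
  fixes v :: "'a::comm_monoid_add Matrix.vec"
  assumes "v \<in> carrier_vec (d + 1)"
  obtains p where "degree p \<le> d" "vec (d + 1) (coeff p) = v"
proof
  let ?p = "\<Sum>k\<le>d. monom (v $ k) k"
  show "degree ?p \<le> d"
    by (intro degree_sum_le) (auto intro: order_trans[OF degree_monom_le])
  show "vec (d + 1) (coeff ?p) = v"
    using assms by (intro eq_vecI) (auto simp: coeff_sum)
qed

text \<open>A kernel vector gives a product p f in f P_d that is orthogonal to f P_d, hence to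
  itself.\<close>

lemma opa_mat_mult_eq_0:
  assumes "f \<in> dirichlet_nonzero \<alpha>" "v \<in> carrier_vec (d + 1)" "opa_mat \<alpha> d f *\<^sub>v v = 0\<^sub>v (d + 1)"
  shows "v = 0\<^sub>v (d + 1)"
proof -
  have f: "f \<in> dirichlet_space \<alpha>" using assms by (simp add: dirichlet_nonzero_def)
  obtain p where p: "degree p \<le> d" "vec (d + 1) (coeff p) = v"
    using coeff_vec_surj[OF assms(2)] .
  let ?g = "\<lambda>z. poly p z * f z"
  have g: "?g \<in> dirichlet_space \<alpha>" by (rule dirichlet_space_poly_mult[OF f])
  have "dirichlet_inner \<alpha> ?g ((shift ^^ j) f) = 0" if "j \<le> d" for j
    using opa_mat_mult_coeff[OF f p(1) that, unfolded p(2)] assms(3) that by simp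
  then have "dirichlet_inner \<alpha> ?g ?g = 0"
    by (intro dirichlet_inner_poly_mult_right_eq_0[OF f g p(1)])
  then have "dirichlet_norm \<alpha> ?g = 0"
    using dirichlet_inner_self[OF g] by simp
  then have "p = 0" by (rule poly_mult_norm_eq_0[OF assms(1)])
  then show ?thesis using p(2) by auto
qed

text \<open>A trivial kernel gives a nonzero determinant, so \<open>mat_inverse\<close> returns
  \<open>Some\<close> and \<open>mat_inv\<close> is the true two-sided inverse.\<close>

lemma mat_inv_opa_mat:
  assumes "f \<in> dirichlet_nonzero \<alpha>"
  shows "mat_inv (opa_mat \<alpha> d f) \<in> carrier_mat (d + 1) (d + 1)"
    and "opa_mat \<alpha> d f * mat_inv (opa_mat \<alpha> d f) = 1\<^sub>m (d + 1)"
    and "mat_inv (opa_mat \<alpha> d f) * opa_mat \<alpha> d f = 1\<^sub>m (d + 1)"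
proof -
  note M = opa_mat_carrier[of \<alpha> d f]
  have "Determinant.det (opa_mat \<alpha> d f) \<noteq> 0"
    using opa_mat_mult_eq_0[OF assms] by (auto simp: det_0_iff_vec_prod_zero[OF M])
  then obtain B where "mat_inverse (opa_mat \<alpha> d f) = Some B"
    using det_non_zero_imp_unit[OF M] mat_inverse(1)[OF M] by fast
  then show "mat_inv (opa_mat \<alpha> d f) \<in> carrier_mat (d + 1) (d + 1)"
    "opa_mat \<alpha> d f * mat_inv (opa_mat \<alpha> d f) = 1\<^sub>m (d + 1)"
    "mat_inv (opa_mat \<alpha> d f) * opa_mat \<alpha> d f = 1\<^sub>m (d + 1)"
    using mat_inverse(2)[OF M] by (auto simp: mat_inv_def)
qed

text \<open>The system says that p f - 1 is orthogonal to each S^j f. Since q f - 1 = (p f - 1) + (q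
  - p) f, Pythagoras applies; the identity yields both minimality and uniqueness.\<close>

lemma solution_error_sq:
  assumes f: "f \<in> dirichlet_space \<alpha>" and p: "degree p \<le> d"
    and sol: "opa_mat \<alpha> d f *\<^sub>v vec (d + 1) (coeff p) = opa_vec \<alpha> d f" and q: "degree q \<le> d"
  shows "(dirichlet_norm \<alpha> (\<lambda>z. poly q z * f z - 1))\<^sup>2
    = (dirichlet_norm \<alpha> (\<lambda>z. poly p z * f z - 1))\<^sup>2
      + (dirichlet_norm \<alpha> (\<lambda>z. poly (q - p) z * f z))\<^sup>2"
proof -
  let ?r = "\<lambda>z. poly p z * f z - 1"
  have r: "?r \<in> dirichlet_space \<alpha>"
    by (intro dirichlet_space_diff dirichlet_space_poly_mult dirichlet_space_one f)
  have "dirichlet_inner \<alpha> ?r ((shift ^^ j) f) = 0" if "j \<le> d" for j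
    using opa_mat_mult_coeff[OF f p that, unfolded sol] that f
    by (simp add: dirichlet_inner_diff_left dirichlet_space_poly_mult dirichlet_space_one
        dirichlet_space_shift_pow opa_vec_def)
  then have "dirichlet_inner \<alpha> ?r (\<lambda>z. poly (q - p) z * f z) = 0"
    by (intro dirichlet_inner_poly_mult_right_eq_0[OF f r degree_diff_le[OF q p]])
  from dirichlet_norm_add_sq_orthogonal[OF r dirichlet_space_poly_mult[OF f] this]
  show ?thesis by (simp add: algebra_simps)
qed

text \<open>The polynomial with coefficient vector M^{-1} b is shown to be the only minimizer, which
  determines the \<open>THE\<close> in \<open>opa\<close>.\<close>

lemma opa_coeffs:
  assumes "f \<in> dirichlet_nonzero \<alpha>"
  shows "degree (opa \<alpha> d f) \<le> d"
    and "opa_mat \<alpha> d f *\<^sub>v vec (d + 1) (coeff (opa \<alpha> d f)) = opa_vec \<alpha> d f"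
proof -
  have f: "f \<in> dirichlet_space \<alpha>" using assms by (simp add: dirichlet_nonzero_def)
  note M = opa_mat_carrier[of \<alpha> d f] and b = opa_vec_carrier[of \<alpha> d f]
  note N = mat_inv_opa_mat[OF assms, of d]
  obtain p where p: "degree p \<le> d"
    and c: "vec (d + 1) (coeff p) = mat_inv (opa_mat \<alpha> d f) *\<^sub>v opa_vec \<alpha> d f"
    using coeff_vec_surj[OF mult_mat_vec_carrier[OF N(1) b]] .
  have sol: "opa_mat \<alpha> d f *\<^sub>v vec (d + 1) (coeff p) = opa_vec \<alpha> d f"
    unfolding c using assoc_mult_mat_vec[OF M N(1) b] N(2) b by simp
  note err = solution_error_sq[OF f p sol]
  have err_norm_nonneg: "0 \<le> dirichlet_norm \<alpha> (\<lambda>z. poly q z * f z - 1)" for q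
    by (intro dirichlet_norm_nonneg dirichlet_space_diff dirichlet_space_poly_mult dirichlet_space_one f)
  have "is_opa \<alpha> d f p"
    unfolding is_opa_def
  proof (intro conjI allI impI p)
    fix q :: "complex poly" assume "degree q \<le> d"
    then have "(dirichlet_norm \<alpha> (\<lambda>z. poly p z * f z - 1))\<^sup>2
        \<le> (dirichlet_norm \<alpha> (\<lambda>z. poly q z * f z - 1))\<^sup>2"
      by (simp add: err)
    then show "dirichlet_norm \<alpha> (\<lambda>z. poly p z * f z - 1) \<le> dirichlet_norm \<alpha> (\<lambda>z. poly q z * f z - 1)"
      by (rule power2_le_imp_le) (rule err_norm_nonneg)
  qed
  \<comment> \<open>A second minimizer has an error no larger than that of p, so the extra square in
    the error identity must vanish.\<close>
  moreover have "q = p" if "is_opa \<alpha> d f q" for q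
  proof -
    from that p have q: "degree q \<le> d"
      and "dirichlet_norm \<alpha> (\<lambda>z. poly q z * f z - 1) \<le> dirichlet_norm \<alpha> (\<lambda>z. poly p z * f z - 1)"
      by (auto simp: is_opa_def)
    then have "(dirichlet_norm \<alpha> (\<lambda>z. poly q z * f z - 1))\<^sup>2
        \<le> (dirichlet_norm \<alpha> (\<lambda>z. poly p z * f z - 1))\<^sup>2"
      by (intro power_mono err_norm_nonneg)
    then have "dirichlet_norm \<alpha> (\<lambda>z. poly (q - p) z * f z) = 0"
      unfolding err[OF q] by simp
    then show "q = p" using poly_mult_norm_eq_0[OF assms] by fastforce
  qed
  ultimately have "opa \<alpha> d f = p"
    unfolding opa_def by (rule the_equality)
  then show "degree (opa \<alpha> d f) \<le> d"
    "opa_mat \<alpha> d f *\<^sub>v vec (d + 1) (coeff (opa \<alpha> d f)) = opa_vec \<alpha> d f"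
    using p sol by auto
qed

section \<open>Perturbation bounds for b, M and the approximant\<close>

section \<open>Stability\<close>

text \<open>Pairing with the constant 1 reads off only the constant coefficient, whose weight is 1,
  and S^k f vanishes at 0 for k \<ge> 1.\<close>

lemma opa_vec_nth:
  assumes "f \<in> dirichlet_space \<alpha>" "k \<le> d"
  shows "opa_vec \<alpha> d f $ k = (if k = 0 then cnj (taylor_coeff f 0) else 0)"
proof -
  have "dirichlet_inner \<alpha> (\<lambda>_. 1) ((shift ^^ k) f) = cnj (taylor_coeff ((shift ^^ k) f) 0)"
    unfolding dirichlet_inner_def
    by (subst suminf_finite[of "{0}"]) (auto simp: taylor_coeff_one)
  moreover have "taylor_coeff ((shift ^^ Suc m) f) 0 = 0" for m
    using dirichlet_space_shift_pow[OF assms(1), of m]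
    by (simp add: taylor_coeff_shift dirichlet_space_holomorphic)
  ultimately show ?thesis
    using assms(2) by (cases k) (auto simp: opa_vec_def simp del: funpow.simps(2))
qed

lemma opa_vec_diff_le:
  assumes f: "f \<in> dirichlet_space \<alpha>" and g: "g \<in> dirichlet_space \<alpha>"
  shows "euclid_norm (opa_vec \<alpha> d g - opa_vec \<alpha> d f) \<le> dirichlet_norm \<alpha> (\<lambda>z. g z - f z)"
proof -
  have dim: "dim_vec (opa_vec \<alpha> d g - opa_vec \<alpha> d f) = Suc d"
    by (simp add: opa_vec_def)
  have nth: "(opa_vec \<alpha> d g - opa_vec \<alpha> d f) $ k
      = (if k = 0 then cnj (taylor_coeff g 0 - taylor_coeff f 0) else 0)" if "k < Suc d" for k
    using that opa_vec_carrier[of \<alpha> d f] f g by (auto simp: opa_vec_nth)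
  have "euclid_norm (opa_vec \<alpha> d g - opa_vec \<alpha> d f)
      = sqrt (\<Sum>k<Suc d. if k = 0 then (cmod (taylor_coeff g 0 - taylor_coeff f 0))\<^sup>2 else 0)"
    unfolding euclid_norm_def dim
    by (intro arg_cong[where f = sqrt] sum.cong refl) (auto simp: nth simp del: complex_cnj_diff)
  also have "\<dots> = cmod (taylor_coeff g 0 - taylor_coeff f 0)"
    by simp
  also have "taylor_coeff g 0 - taylor_coeff f 0 = taylor_coeff (\<lambda>z. g z - f z) 0"
    using taylor_coeff_add[of g "\<lambda>z. - 1 * f z" 0] taylor_coeff_cmult[of f "-1" 0]
      dirichlet_space_holomorphic[OF f] dirichlet_space_holomorphic[OF g]
    by (simp add: holomorphic_intros)
  also have "cmod \<dots> \<le> dirichlet_norm \<alpha> (\<lambda>z. g z - f z)"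
    using dirichlet_norm_coeff_le[OF dirichlet_space_diff[OF g f], of 0] by simp
  finally show ?thesis .
qed

text \<open>In the constant, the square comes from one shift bound for each argument of the inner
  product, and d + 1 from passing from entries to the Frobenius norm.\<close>

lemma opa_mat_diff_le:
  assumes f: "f \<in> dirichlet_space \<alpha>" and g: "g \<in> dirichlet_space \<alpha>"
  shows "frob_norm (opa_mat \<alpha> d g - opa_mat \<alpha> d f)
    \<le> (real (d + 1) * (sqrt (2 powr \<bar>\<alpha>\<bar>) ^ d)\<^sup>2) * (dirichlet_norm \<alpha> g + dirichlet_norm \<alpha> f)
      * dirichlet_norm \<alpha> (\<lambda>z. g z - f z)"
proof -
  define K where "K = sqrt (2 powr \<bar>\<alpha>\<bar>) ^ d"
  let ?h = "\<lambda>z. g z - f z"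
  have h: "?h \<in> dirichlet_space \<alpha>" by (rule dirichlet_space_diff[OF g f])
  have K: "0 \<le> K" by (simp add: K_def)
  let ?C = "K\<^sup>2 * (dirichlet_norm \<alpha> g + dirichlet_norm \<alpha> f) * dirichlet_norm \<alpha> ?h"
  have bound: "cmod (dirichlet_inner \<alpha> ((shift ^^ k) u) ((shift ^^ j) v))
      \<le> K\<^sup>2 * dirichlet_norm \<alpha> u * dirichlet_norm \<alpha> v"
    if "u \<in> dirichlet_space \<alpha>" "v \<in> dirichlet_space \<alpha>" "j \<le> d" "k \<le> d" for u v j k
  proof -
    have "cmod (dirichlet_inner \<alpha> ((shift ^^ k) u) ((shift ^^ j) v))
        \<le> dirichlet_norm \<alpha> ((shift ^^ k) u) * dirichlet_norm \<alpha> ((shift ^^ j) v)"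
      by (intro dirichlet_Cauchy_Schwarz dirichlet_space_shift_pow that)
    also have "\<dots> \<le> (K * dirichlet_norm \<alpha> u) * (K * dirichlet_norm \<alpha> v)"
      unfolding K_def
      by (intro mult_mono dirichlet_norm_shift_pow_le that dirichlet_norm_nonneg
          dirichlet_space_shift_pow mult_nonneg_nonneg) auto
    finally show ?thesis by (simp add: power2_eq_square mult_ac)
  qed
  have "cmod ((opa_mat \<alpha> d g - opa_mat \<alpha> d f) $$ (j, k)) \<le> ?C" if "j < d + 1" "k < d + 1" for j k
  proof -
    note S = dirichlet_space_shift_pow
    have "(opa_mat \<alpha> d g - opa_mat \<alpha> d f) $$ (j, k)
        = dirichlet_inner \<alpha> ((shift ^^ k) g) ((shift ^^ j) g)
          - dirichlet_inner \<alpha> ((shift ^^ k) f) ((shift ^^ j) f)"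
      using that by (simp add: opa_mat_def)
    \<comment> \<open>The mixed term <S^k f, S^j g> is subtracted and added.\<close>
    also have "\<dots> = dirichlet_inner \<alpha> ((shift ^^ k) ?h) ((shift ^^ j) g)
        + dirichlet_inner \<alpha> ((shift ^^ k) f) ((shift ^^ j) ?h)"
      unfolding shift_pow_diff
      by (simp add: dirichlet_inner_diff_left[OF S[OF g] S[OF f] S[OF g]]
          dirichlet_inner_diff_right[OF S[OF g] S[OF f] S[OF f]])
    finally have "cmod ((opa_mat \<alpha> d g - opa_mat \<alpha> d f) $$ (j, k))
        = cmod (dirichlet_inner \<alpha> ((shift ^^ k) ?h) ((shift ^^ j) g)
          + dirichlet_inner \<alpha> ((shift ^^ k) f) ((shift ^^ j) ?h))"
      by (rule arg_cong)
    also have "\<dots> \<le> K\<^sup>2 * dirichlet_norm \<alpha> ?h * dirichlet_norm \<alpha> g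
        + K\<^sup>2 * dirichlet_norm \<alpha> f * dirichlet_norm \<alpha> ?h"
      using that by (intro norm_triangle_mono bound f g h) auto
    also have "\<dots> = ?C" by (simp add: algebra_simps)
    finally show ?thesis .
  qed
  moreover have "0 \<le> ?C"
    using f g h by (simp add: dirichlet_norm_nonneg)
  ultimately have "frob_norm (opa_mat \<alpha> d g - opa_mat \<alpha> d f) \<le> real (d + 1) * ?C"
    using frob_norm_le_entries[OF minus_carrier_mat[OF opa_mat_carrier]] by blast
  then show ?thesis by (simp only: K_def mult.assoc)
qed

text \<open>The usual perturbation argument for linear systems, with g in the role of f_n; primed
  names belong to g.\<close>

lemma opa_diff_le:
  assumes f: "f \<in> dirichlet_nonzero \<alpha>" and g: "g \<in> dirichlet_nonzero \<alpha>"
  shows "dirichlet_norm \<alpha> (\<lambda>z. poly (opa \<alpha> d g) z - poly (opa \<alpha> d f) z)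
    \<le> sqrt (\<Sum>k\<le>d. (real k + 1) powr \<alpha>) * frob_norm (mat_inv (opa_mat \<alpha> d g))
      * (euclid_norm (opa_vec \<alpha> d g - opa_vec \<alpha> d f)
        + frob_norm (mat_inv (opa_mat \<alpha> d f)) * frob_norm (opa_mat \<alpha> d f - opa_mat \<alpha> d g)
          * euclid_norm (opa_vec \<alpha> d f))"
proof -
  define M where "M = opa_mat \<alpha> d f"
  define M' where "M' = opa_mat \<alpha> d g"
  define b where "b = opa_vec \<alpha> d f"
  define b' where "b' = opa_vec \<alpha> d g"
  define c where "c = vec (d + 1) (coeff (opa \<alpha> d f))"
  define c' where "c' = vec (d + 1) (coeff (opa \<alpha> d g))"
  have carr: "M \<in> carrier_mat (d + 1) (d + 1)" "M' \<in> carrier_mat (d + 1) (d + 1)"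
    "b \<in> carrier_vec (d + 1)" "b' \<in> carrier_vec (d + 1)"
    "c \<in> carrier_vec (d + 1)" "c' \<in> carrier_vec (d + 1)"
    by (simp_all add: M_def M'_def b_def b'_def c_def c'_def opa_mat_def opa_vec_def)
  note N = mat_inv_opa_mat[OF f, of d, folded M_def]
  note N' = mat_inv_opa_mat[OF g, of d, folded M'_def]
  have sol: "M *\<^sub>v c = b" "M' *\<^sub>v c' = b'"
    using opa_coeffs(2)[OF f] opa_coeffs(2)[OF g]
    by (auto simp: M_def M'_def b_def b'_def c_def c'_def)
  have c: "c = mat_inv M *\<^sub>v b"
    using assoc_mult_mat_vec[OF N(1) carr(1) carr(5)] N(3) sol carr by simp
  \<comment> \<open>M'(c' - c) = b' - M' c, and b = M c is subtracted and added.\<close>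
  have res: "M' *\<^sub>v (c' - c) = (b' - b) + (M - M') *\<^sub>v c"
    using carr mult_minus_distrib_mat_vec[OF carr(2,6,5)] minus_mult_distrib_mat_vec[OF carr(1,2,5)] sol
    by (intro eq_vecI) auto
  have "c' - c = mat_inv M' *\<^sub>v ((b' - b) + (M - M') *\<^sub>v c)"
    unfolding res[symmetric]
    using assoc_mult_mat_vec[OF N'(1) carr(2), of "c' - c"] N'(3) carr by simp
  then have "euclid_norm (c' - c) \<le> frob_norm (mat_inv M') * euclid_norm ((b' - b) + (M - M') *\<^sub>v c)"
    using N'(1) carr by (auto intro!: euclid_norm_mult_mat_vec_le)
  also have "\<dots> \<le> frob_norm (mat_inv M') * (euclid_norm (b' - b) + euclid_norm ((M - M') *\<^sub>v c))"
    using carr by (intro mult_left_mono euclid_norm_add_le frob_norm_nonneg) auto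
  also have "\<dots> \<le> frob_norm (mat_inv M') * (euclid_norm (b' - b)
      + frob_norm (M - M') * (frob_norm (mat_inv M) * euclid_norm b))"
  proof (intro mult_left_mono add_left_mono frob_norm_nonneg)
    have "euclid_norm ((M - M') *\<^sub>v c) \<le> frob_norm (M - M') * euclid_norm c"
      using carr by (intro euclid_norm_mult_mat_vec_le) auto
    also have "\<dots> \<le> frob_norm (M - M') * (frob_norm (mat_inv M) * euclid_norm b)"
      unfolding c using carr N(1)
      by (intro mult_left_mono euclid_norm_mult_mat_vec_le frob_norm_nonneg) auto
    finally show "euclid_norm ((M - M') *\<^sub>v c)
        \<le> frob_norm (M - M') * (frob_norm (mat_inv M) * euclid_norm b)" .
  qed
  finally have main: "euclid_norm (c' - c) \<le> frob_norm (mat_inv M') * (euclid_norm (b' - b)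
      + frob_norm (mat_inv M) * frob_norm (M - M') * euclid_norm b)"
    by (simp only: mult_ac)
  have diff: "c' - c = vec (d + 1) (coeff (opa \<alpha> d g - opa \<alpha> d f))"
    by (intro eq_vecI) (auto simp: c_def c'_def)
  have "dirichlet_norm \<alpha> (\<lambda>z. poly (opa \<alpha> d g) z - poly (opa \<alpha> d f) z)
      = dirichlet_norm \<alpha> (poly (opa \<alpha> d g - opa \<alpha> d f))"
    by (simp add: poly_diff[abs_def])
  also have "\<dots> \<le> sqrt (\<Sum>k\<le>d. (real k + 1) powr \<alpha>) * euclid_norm (c' - c)"
    unfolding diff by (intro dirichlet_norm_poly_le degree_diff_le opa_coeffs f g)
  also have "\<dots> \<le> sqrt (\<Sum>k\<le>d. (real k + 1) powr \<alpha>) * (frob_norm (mat_inv M') * (euclid_norm (b' - b)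
      + frob_norm (mat_inv M) * frob_norm (M - M') * euclid_norm b))"
    by (intro mult_left_mono main) (simp add: sum_nonneg)
  finally show ?thesis
    by (simp only: M_def M'_def b_def b'_def mult.assoc)
qed

theorem theorem4p1:
  fixes \<alpha> :: real and d :: nat
  shows "(\<exists>\<phi>::real. \<forall>(F :: nat \<Rightarrow> complex \<Rightarrow> complex) f.
            (\<forall>n\<ge>1. F n \<in> dirichlet_nonzero \<alpha>) \<and> f \<in> dirichlet_nonzero \<alpha> \<longrightarrow>
            (\<forall>n\<ge>1.
               euclid_norm (opa_vec \<alpha> d (F n) - opa_vec \<alpha> d f)
                 \<le> dirichlet_norm \<alpha> (\<lambda>z. F n z - f z) \<and>
               frob_norm (opa_mat \<alpha> d (F n) - opa_mat \<alpha> d f)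
                 \<le> \<phi> * (dirichlet_norm \<alpha> (F n) + dirichlet_norm \<alpha> f)
                     * dirichlet_norm \<alpha> (\<lambda>z. F n z - f z))) \<and>
         (\<exists>\<psi>::real. \<forall>(F :: nat \<Rightarrow> complex \<Rightarrow> complex) f.
            (\<forall>n\<ge>1. F n \<in> dirichlet_nonzero \<alpha>) \<and> f \<in> dirichlet_nonzero \<alpha> \<longrightarrow>
            (\<forall>n\<ge>1.
               dirichlet_norm \<alpha> (\<lambda>z. poly (opa \<alpha> d (F n)) z - poly (opa \<alpha> d f) z)
                 \<le> \<psi> * frob_norm (mat_inv (opa_mat \<alpha> d (F n)))
                     * (euclid_norm (opa_vec \<alpha> d (F n) - opa_vec \<alpha> d f)
                        + frob_norm (mat_inv (opa_mat \<alpha> d f))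
                          * frob_norm (opa_mat \<alpha> d f - opa_mat \<alpha> d (F n))
                          * euclid_norm (opa_vec \<alpha> d f))))"
\<comment> \<open>The witnesses remain schematic until the estimates below fix them. They are
  introduced before \<open>F\<close>, \<open>f\<close> and \<open>n\<close>, so they can depend on
  \<alpha> and \<open>d\<close> only.\<close>
proof (intro conjI exI allI impI; elim conjE)
  fix F :: "nat \<Rightarrow> complex \<Rightarrow> complex" and f n
  assume "\<forall>n\<ge>1. F n \<in> dirichlet_nonzero \<alpha>" "f \<in> dirichlet_nonzero \<alpha>" "(1::nat) \<le> n"
  then have nz: "f \<in> dirichlet_nonzero \<alpha>" "F n \<in> dirichlet_nonzero \<alpha>"
    and space: "f \<in> dirichlet_space \<alpha>" "F n \<in> dirichlet_space \<alpha>"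
    by (auto simp: dirichlet_nonzero_def)
  show "euclid_norm (opa_vec \<alpha> d (F n) - opa_vec \<alpha> d f) \<le> dirichlet_norm \<alpha> (\<lambda>z. F n z - f z)"
    by (rule opa_vec_diff_le[OF space])
  show "frob_norm (opa_mat \<alpha> d (F n) - opa_mat \<alpha> d f)
      \<le> (real (d + 1) * (sqrt (2 powr \<bar>\<alpha>\<bar>) ^ d)\<^sup>2)
        * (dirichlet_norm \<alpha> (F n) + dirichlet_norm \<alpha> f) * dirichlet_norm \<alpha> (\<lambda>z. F n z - f z)"
    by (rule opa_mat_diff_le[OF space])
  show "dirichlet_norm \<alpha> (\<lambda>z. poly (opa \<alpha> d (F n)) z - poly (opa \<alpha> d f) z)
      \<le> sqrt (\<Sum>k\<le>d. (real k + 1) powr \<alpha>) * frob_norm (mat_inv (opa_mat \<alpha> d (F n)))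
        * (euclid_norm (opa_vec \<alpha> d (F n) - opa_vec \<alpha> d f)
          + frob_norm (mat_inv (opa_mat \<alpha> d f)) * frob_norm (opa_mat \<alpha> d f - opa_mat \<alpha> d (F n))
            * euclid_norm (opa_vec \<alpha> d f))"
    by (rule opa_diff_le[OF nz])
qed

end
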